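(* Let $\mathcal A=\{A_1,\dots,A_M\}\subset\mathbb R^{n\times n}$ be a finite set of matrices and let $G=(S,E)$ be a path-complete directed labeled graph on $\{1,\dots,M\}$. Suppose that the optimization problem defining $\gamma^\star(G)$ admits an optimal solution $(\gamma^\star,\{P_a^\star\}_{a\in S})$ (a feasible solution with $\gamma^\star=\gamma^\star(G)$). Let $\tilde G=(S,\tilde E)$ be the tight subgraph associated with this solution. Assume that in $\tilde G$ every node has at most one outgoing edge. Then $\gamma^\star(G)=\rho(\mathcal A)$.
   Context: A directed labeled graph on $\{1,\dots,M\}$ is a pair $G=(S,E)$ where $S$ is a finite set of nodes and $E\subseteq S\times S\times\{1,\dots,M\}$; an element $(a,b,i)\in E$ is a directed edge from $a$ to $b$ labeled by $i$. The outgoing edges of $a$ are the triples $(a,b,i)\in E$ (edges with different labels are counted separately, and self-loops count). $G$ is path-complete if for every integer $K\ge 1$ and every sequence $(i_1,\dots,i_K)\in\{1,\dots,M\}^K$ there exist nodes $a_1,\dots,a_{K+1}\in S$ such that $(a_k,a_{k+1},i_k)\in E$ for all $k=1,\dots,K$. For a directed labeled graph $G=(S,E)$ and the matrices $A_1,\dots,A_M\in\mathbb R^{n\times n}$, $\gamma^\star(G)$ denotes the optimal value (infimum) of the problem: minimize $\gamma$ over $\gamma\ge 0$ and real symmetric $n\times n$ matrices $\{P_a\}_{a\in S}$ subject to $\gamma^2P_a\succeq A_i^\top P_bA_i$ for all $(a,b,i)\in E$, and $P_a\succ 0$ for all $a\in S$. Here $\succeq$ is the positive semidefinite order and $\succ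 0$ means positive definite. Given a feasible solution $(\gamma,\{P_a\}_{a\in S})$ of this problem on $G$, the associated tight subgraph is $\tilde G=(S,\tilde E)$ with $$\tilde E=\{(a,b,i)\in E:\lambda_{\min}(\gamma^2P_a-A_i^\top P_bA_i)=0\},$$ where $\lambda_{\min}$ denotes the smallest eigenvalue. The joint spectral radius of $\mathcal A$ is $\rho(\mathcal A)=\lim_{k\to\infty}\max_{\sigma\in\{1,\dots,M\}^k}\|A_{\sigma_k}\cdots A_{\sigma_2}A_{\sigma_1}\|^{1/k}$ (independent of the chosen norm). *)

theory Defs
  imports "HOL-Analysis.Analysis"
begin

type_synonym 'a ledge = "'a \<times> 'a \<times> nat"

definition labeled_digraph :: "nat \<Rightarrow> 'a set \<Rightarrow> 'a ledge set \<Rightarrow> bool" where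
  "labeled_digraph M S E \<longleftrightarrow> finite S \<and> E \<subseteq> S \<times> S \<times> {1..M}"

definition outgoing :: "'a ledge set \<Rightarrow> 'a \<Rightarrow> 'a ledge set" where
  "outgoing E a = {(a', b, i) \<in> E. a' = a}"

definition path_complete :: "nat \<Rightarrow> 'a set \<Rightarrow> 'a ledge set \<Rightarrow> bool" where
  "path_complete M S E \<longleftrightarrow>
     (\<forall>K \<ge> 1. \<forall>\<sigma> :: nat \<Rightarrow> nat. (\<forall>k \<in> {1..K}. \<sigma> k \<in> {1..M}) \<longrightarrow>
        (\<exists>v :: nat \<Rightarrow> 'a. (\<forall>k \<in> {1..K + 1}. v k \<in> S) \<and>
                       (\<forall>k \<in> {1..K}. (v k, v (k + 1), \<sigma> k) \<in> E)))"

definition symmetric_matrix :: "real^'n^'n \<Rightarrow> bool" where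
  "symmetric_matrix Q \<longleftrightarrow> transpose Q = Q"

definition pos_semidef :: "real^'n^'n \<Rightarrow> bool" where
  "pos_semidef Q \<longleftrightarrow> symmetric_matrix Q \<and> (\<forall>x. 0 \<le> x \<bullet> (Q *v x))"

definition pos_def :: "real^'n^'n \<Rightarrow> bool" where
  "pos_def Q \<longleftrightarrow> symmetric_matrix Q \<and> (\<forall>x. x \<noteq> 0 \<longrightarrow> 0 < x \<bullet> (Q *v x))"

definition eigenvalues :: "real^'n^'n \<Rightarrow> real set" where
  "eigenvalues Q = {l. \<exists>v. v \<noteq> 0 \<and> Q *v v = l *\<^sub>R v}"

text \<open>Only meaningful for symmetric matrices, whose set of real eigenvalues is finite and nonempty.\<close>

definition lambda_min :: "real^'n^'n \<Rightarrow> real" where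
  "lambda_min Q = Min (eigenvalues Q)"

definition edge_slack ::
  "(nat \<Rightarrow> real^'n^'n) \<Rightarrow> real \<Rightarrow> ('a \<Rightarrow> real^'n^'n) \<Rightarrow> 'a \<Rightarrow> 'a \<Rightarrow> nat \<Rightarrow> real^'n^'n" where
  "edge_slack A \<gamma> P a b i = \<gamma>\<^sup>2 *\<^sub>R P a - transpose (A i) ** P b ** A i"

definition feasible ::
  "(nat \<Rightarrow> real^'n^'n) \<Rightarrow> 'a set \<Rightarrow> 'a ledge set \<Rightarrow> real \<Rightarrow> ('a \<Rightarrow> real^'n^'n) \<Rightarrow> bool" where
  "feasible A S E \<gamma> P \<longleftrightarrow>
     0 \<le> \<gamma> \<and> (\<forall>a \<in> S. pos_def (P a)) \<and>
     (\<forall>(a, b, i) \<in> E. pos_semidef (edge_slack A \<gamma> P a b i))"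

text \<open>
  The set below is bounded below by 0, and it is nonempty for every labeled digraph in the
  above sense (take all matrices equal to the identity and \<open>\<gamma>\<close> large), so that the real-valued
  infimum is the true one.
\<close>

definition gamma_star :: "(nat \<Rightarrow> real^'n^'n) \<Rightarrow> 'a set \<Rightarrow> 'a ledge set \<Rightarrow> real" where
  "gamma_star A S E = Inf {\<gamma>. \<exists>P. feasible A S E \<gamma> P}"

definition tight_edges ::
  "(nat \<Rightarrow> real^'n^'n) \<Rightarrow> 'a ledge set \<Rightarrow> real \<Rightarrow> ('a \<Rightarrow> real^'n^'n) \<Rightarrow> 'a ledge set" where
  "tight_edges A E \<gamma> P = {(a, b, i) \<in> E. lambda_min (edge_slack A \<gamma> P a b i) = 0}"

text \<open>The first letter of the word acts first: the word \<open>[i, j]\<close> is sent to \<open>A j ** A i\<close>.\<close>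

fun word_prod :: "(nat \<Rightarrow> real^'n^'n) \<Rightarrow> nat list \<Rightarrow> real^'n^'n" where
  "word_prod A [] = mat 1"
| "word_prod A (i # w) = word_prod A w ** A i"

text \<open>
  The norm is the spectral norm, i.e. the operator norm for the Euclidean norm on vectors.
  For \<open>M \<ge> 1\<close> the maximum is over a finite nonempty set and the limit exists.
\<close>

definition joint_spectral_radius :: "nat \<Rightarrow> (nat \<Rightarrow> real^'n^'n) \<Rightarrow> real" where
  "joint_spectral_radius M A =
     lim (\<lambda>k. Max ((\<lambda>w. onorm ((*v) (word_prod A w)) powr (1 / real k)) `
                   {w. length w = k \<and> set w \<subseteq> {1..M}}))"

end

theory Submission
  imports Defs
begin

text \<open>
  Along a path of the graph the quadratic forms \<open>P a\<close> grow by at most \<open>\<gamma>\<^sup>2\<close> per step, so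
  path-completeness gives \<open>\<parallel>A\<^sub>w\<parallel> \<le> C \<gamma>\<^sup>k\<close> for all words \<open>w\<close> of length \<open>k\<close>.
  Conversely, suppose that \<open>\<parallel>A\<^sub>w\<parallel> < \<gamma>\<^sup>N\<close> for all words of some length \<open>N \<ge> 1\<close>. Let \<open>B\<^sub>k a\<close> be
  the matrix product along the unique tight path of length \<open>k\<close> that starts in \<open>a\<close> (zero if the path
  stops earlier), and let \<open>Q a = (\<Sum>k<N. \<gamma>\<^bsup>2(N - 1 - k)\<^esup> B\<^sub>k a\<^sup>T B\<^sub>k a)\<close>. By telescoping, the slack of \<open>Q\<close>
  on a tight edge leaving \<open>a\<close> is \<open>\<gamma>\<^bsup>2N\<^esup> I - B\<^sub>N a\<^sup>T B\<^sub>N a\<close>, which is positive definite. Hence \<open>P + \<epsilon> Q\<close> has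
  positive definite slack on every edge for small \<open>\<epsilon> > 0\<close>, and \<open>\<gamma>\<close> can be decreased. So at optimality
  the maximal norm over words of length \<open>k\<close> lies between \<open>\<gamma>\<^sup>k\<close> and \<open>C \<gamma>\<^sup>k\<close>.
\<close>

section \<open>Symmetric and positive definite matrices\<close>

lemma inner_congruence:
  fixes B Q :: "real^'n^'n"
  shows "x \<bullet> ((transpose B ** Q ** B) *v x) = (B *v x) \<bullet> (Q *v (B *v x))"
  by (metis dot_lmul_matrix inner_commute matrix_vector_mul_assoc transpose_matrix_vector)

lemma symmetric_matrix_inner:
  "symmetric_matrix Q \<Longrightarrow> x \<bullet> (Q *v y) = (Q *v x) \<bullet> y"
  by (metis dot_lmul_matrix symmetric_matrix_def transpose_matrix_vector)

lemma transpose_add: "transpose (A + B) = transpose A + transpose (B :: real^'n^'m)"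
  by (simp add: transpose_def vec_eq_iff)

lemma transpose_diff: "transpose (A - B) = transpose A - transpose (B :: real^'n^'m)"
  by (simp add: transpose_def vec_eq_iff)

lemma transpose_scaleR: "transpose (c *\<^sub>R A) = c *\<^sub>R transpose (A :: real^'n^'m)"
  by (simp add: transpose_def vec_eq_iff)

lemma transpose_sum: "transpose (sum f I) = (\<Sum>i\<in>I. transpose (f i :: real^'n^'m))"
  by (simp add: transpose_def vec_eq_iff)

lemma symmetric_matrix_add:
  "symmetric_matrix A \<Longrightarrow> symmetric_matrix B \<Longrightarrow> symmetric_matrix (A + B)"
  by (simp add: symmetric_matrix_def transpose_add)

lemma symmetric_matrix_scaleR: "symmetric_matrix A \<Longrightarrow> symmetric_matrix (c *\<^sub>R A)"
  by (simp add: symmetric_matrix_def transpose_scaleR)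

lemma symmetric_matrix_edge_slack:
  assumes "symmetric_matrix (P a)" "symmetric_matrix (P b)"
  shows "symmetric_matrix (edge_slack A \<gamma> P a b i)"
  using assms
  by (simp add: symmetric_matrix_def edge_slack_def transpose_diff transpose_scaleR
      matrix_transpose_mul matrix_mul_assoc)

lemma inner_edge_slack:
  "x \<bullet> (edge_slack A \<gamma> P a b i *v x) =
     \<gamma>\<^sup>2 * (x \<bullet> (P a *v x)) - (A i *v x) \<bullet> (P b *v (A i *v x))"
  by (simp add: edge_slack_def matrix_vector_mult_diff_rdistrib inner_diff_right
      inner_congruence scaleR_matrix_vector_assoc [symmetric])

lemma pos_def_imp_pos_semidef: "pos_def Q \<Longrightarrow> pos_semidef Q"
  unfolding pos_def_def pos_semidef_def by (metis inner_zero_left less_imp_le order_refl)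

text \<open>The unit sphere is compact, so the quadratic form attains a positive minimum there;
  homogeneity of degree two carries the bound to all vectors.\<close>

lemma pos_def_lower_bound:
  fixes Q :: "real^'n^'n"
  assumes "pos_def Q"
  obtains c where "c > 0" "\<And>x. c * (norm x)\<^sup>2 \<le> x \<bullet> (Q *v x)"
proof -
  let ?S = "sphere (0 :: real^'n) 1"
  have "axis undefined 1 \<in> ?S"
    by simp
  then have "?S \<noteq> {}"
    by blast
  moreover have "continuous_on ?S (\<lambda>x. x \<bullet> (Q *v x))"
    by (intro continuous_intros linear_continuous_on matrix_vector_mul_bounded_linear)
  ultimately obtain z where z: "z \<in> ?S" "\<And>y. y \<in> ?S \<Longrightarrow> z \<bullet> (Q *v z) \<le> y \<bullet> (Q *v y)"
    using continuous_attains_inf [of ?S "\<lambda>x. x \<bullet> (Q *v x)"] by auto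
  show thesis
  proof
    show "z \<bullet> (Q *v z) > 0"
      using assms z(1) unfolding pos_def_def by (metis dist_self mem_sphere zero_neq_one)
    show "z \<bullet> (Q *v z) * (norm x)\<^sup>2 \<le> x \<bullet> (Q *v x)" for x
    proof (cases "x = 0")
      case False
      let ?y = "(1 / norm x) *\<^sub>R x"
      have "x \<bullet> (Q *v x) = (norm x *\<^sub>R ?y) \<bullet> (Q *v (norm x *\<^sub>R ?y))"
        using False by simp
      also have "\<dots> = (?y \<bullet> (Q *v ?y)) * (norm x)\<^sup>2"
        unfolding matrix_vector_mult_scaleR inner_scaleR_left inner_scaleR_right
        by (simp add: power2_eq_square)
      finally show ?thesis
        using mult_right_mono [OF z(2) [of ?y] zero_le_power2 [of "norm x"]] False by simp
    qed simp
  qed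
qed

lemma abs_quadratic_form_le:
  fixes Q :: "real^'n^'n"
  shows "\<bar>x \<bullet> (Q *v x)\<bar> \<le> onorm ((*v) Q) * (norm x)\<^sup>2"
proof -
  have "\<bar>x \<bullet> (Q *v x)\<bar> \<le> norm x * norm (Q *v x)"
    by (rule Cauchy_Schwarz_ineq2)
  also have "\<dots> \<le> norm x * (onorm ((*v) Q) * norm x)"
    by (intro mult_left_mono onorm matrix_vector_mul_bounded_linear) simp
  finally show ?thesis
    by (simp add: power2_eq_square mult_ac)
qed

lemma eventually_pos_def_perturb:
  fixes R R' :: "real^'n^'n"
  assumes "pos_def R" "symmetric_matrix R'"
  shows "\<forall>\<^sub>F \<epsilon> in at_right 0. pos_def (R + \<epsilon> *\<^sub>R R')"
proof -
  obtain c where c: "c > 0" "\<And>x. c * (norm x)\<^sup>2 \<le> x \<bullet> (R *v x)"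
    using pos_def_lower_bound [OF assms(1)] by blast
  let ?K = "onorm ((*v) R')"
  have K: "?K \<ge> 0"
    by (intro onorm_pos_le matrix_vector_mul_bounded_linear)
  have "((\<lambda>\<epsilon>. \<epsilon> * ?K) \<longlongrightarrow> 0 * ?K) (at_right 0)"
    by (intro tendsto_intros)
  then have "\<forall>\<^sub>F \<epsilon> in at_right 0. \<epsilon> * ?K < c"
    using c(1) by (auto dest: order_tendstoD(2))
  then show ?thesis
    using eventually_at_right_less
  proof eventually_elim
    case (elim \<epsilon>)
    have "0 < x \<bullet> ((R + \<epsilon> *\<^sub>R R') *v x)" if "x \<noteq> 0" for x
    proof -
      have "- (\<epsilon> * (x \<bullet> (R' *v x))) \<le> \<epsilon> * (?K * (norm x)\<^sup>2)"
        unfolding mult_minus_right [symmetric]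
        using abs_quadratic_form_le [of x R'] elim(2) by (intro mult_left_mono) auto
      also have "\<dots> < c * (norm x)\<^sup>2"
        using elim(1) that by (simp add: mult.assoc [symmetric])
      also have "\<dots> \<le> x \<bullet> (R *v x)"
        by (rule c(2))
      finally show ?thesis
        by (simp add: matrix_vector_mult_add_rdistrib inner_add_right
            scaleR_matrix_vector_assoc [symmetric])
    qed
    then show ?case
      using assms unfolding pos_def_def
      by (auto intro: symmetric_matrix_add symmetric_matrix_scaleR)
  qed
qed

section \<open>Eigenvalues of symmetric and semidefinite matrices\<close>

text \<open>Eigenvectors for distinct eigenvalues are orthogonal, and a pairwise orthogonal set is
  finite. This makes the \<open>Min\<close> in \<open>lambda_min\<close> a genuine minimum.\<close>

lemma finite_eigenvalues:
  fixes Q :: "real^'n^'n"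
  assumes "symmetric_matrix Q"
  shows "finite (eigenvalues Q)"
proof -
  have "\<forall>l \<in> eigenvalues Q. \<exists>v. v \<noteq> 0 \<and> Q *v v = l *\<^sub>R v"
    by (simp add: eigenvalues_def)
  from bchoice [OF this] obtain v where v: "\<And>l. l \<in> eigenvalues Q \<Longrightarrow> v l \<noteq> 0"
      "\<And>l. l \<in> eigenvalues Q \<Longrightarrow> Q *v v l = l *\<^sub>R v l"
    by blast
  have orth: "v l \<bullet> v m = 0" if "l \<in> eigenvalues Q" "m \<in> eigenvalues Q" "l \<noteq> m" for l m
  proof -
    have "m * (v l \<bullet> v m) = l * (v l \<bullet> v m)"
      using symmetric_matrix_inner [OF assms, of "v l" "v m"] v that by simp
    then show ?thesis
      using that(3) by simp
  qed
  have "inj_on v (eigenvalues Q)"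
    using orth v(1) by (metis inj_onI inner_eq_zero_iff)
  moreover have "finite (v ` eigenvalues Q)"
    by (rule pairwise_orthogonal_imp_finite)
      (use orth in \<open>auto simp: pairwise_def orthogonal_def\<close>)
  ultimately show ?thesis
    by (simp add: finite_image_iff)
qed

text \<open>Moving from \<open>x\<close> by \<open>t\<close> times \<open>Q *v x\<close> changes the
  form by a linear term \<open>2 * t * (?y \<bullet> ?y)\<close> and a quadratic one; nonnegativity
  for all \<open>t\<close> forces the linear term to vanish.\<close>

lemma pos_semidef_kernel:
  fixes Q :: "real^'n^'n"
  assumes "pos_semidef Q" "x \<bullet> (Q *v x) = 0"
  shows "Q *v x = 0"
proof -
  let ?y = "Q *v x"
  have sym: "symmetric_matrix Q" and nn: "\<And>z. 0 \<le> z \<bullet> (Q *v z)"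
    using assms(1) by (auto simp: pos_semidef_def)
  have "(x + t *\<^sub>R ?y) \<bullet> (Q *v (x + t *\<^sub>R ?y)) = 2 * t * (?y \<bullet> ?y) + t\<^sup>2 * (?y \<bullet> (Q *v ?y))" for t
    using assms(2) symmetric_matrix_inner [OF sym, of x ?y]
    by (simp add: matrix_vector_right_distrib matrix_vector_mult_scaleR inner_add_left
        inner_add_right power2_eq_square algebra_simps)
  then have *: "0 \<le> 2 * t * (?y \<bullet> ?y) + t\<^sup>2 * (?y \<bullet> (Q *v ?y))" for t
    by (metis nn)
  \<comment> \<open>The summand 1 gives a positive \<open>k\<close> above the quadratic coefficient.
    The value \<open>t = - ?Y / k\<close> used below minimises
    \<open>2 * t * ?Y + t\<^sup>2 * k\<close>.\<close>
  define k where "k = ?y \<bullet> (Q *v ?y) + 1"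
  have k: "k > 0" "?y \<bullet> (Q *v ?y) < k"
    using nn [of ?y] by (auto simp: k_def)
  let ?Y = "?y \<bullet> ?y"
  have "0 \<le> 2 * (- ?Y / k) * ?Y + (- ?Y / k)\<^sup>2 * (?y \<bullet> (Q *v ?y))"
    by (rule *)
  also have "\<dots> \<le> 2 * (- ?Y / k) * ?Y + (- ?Y / k)\<^sup>2 * k"
    using k by (intro add_left_mono mult_left_mono) auto
  also have "\<dots> = - (?Y\<^sup>2 / k)"
    using k by (simp add: field_simps power2_eq_square)
  finally have "?Y\<^sup>2 / k \<le> 0"
    by simp
  then have "?Y = 0"
    using k(1) by (simp add: divide_le_0_iff)
  then show ?thesis
    by simp
qed

text \<open>If definiteness fails, the form vanishes at some nonzero vector, which then lies in the
  kernel. So 0 is an eigenvalue, and it is the least one because semidefiniteness excludes negative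
  ones.\<close>

lemma pos_def_if_lambda_min_nonzero:
  fixes Q :: "real^'n^'n"
  assumes "pos_semidef Q" "lambda_min Q \<noteq> 0"
  shows "pos_def Q"
proof (rule ccontr)
  assume "\<not> pos_def Q"
  then obtain x where x: "x \<noteq> 0" "x \<bullet> (Q *v x) = 0"
    using assms(1) unfolding pos_def_def pos_semidef_def by (auto simp: less_le)
  have "0 \<in> eigenvalues Q"
    using x(1) pos_semidef_kernel [OF assms(1) x(2)] unfolding eigenvalues_def by auto
  moreover have "0 \<le> l" if l: "l \<in> eigenvalues Q" for l
  proof -
    obtain v where v: "v \<noteq> 0" "Q *v v = l *\<^sub>R v"
      using l unfolding eigenvalues_def by blast
    have "0 \<le> v \<bullet> (Q *v v)"
      using assms(1) by (simp add: pos_semidef_def)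
    then have "0 \<le> l * (v \<bullet> v)"
      by (simp only: v(2) inner_scaleR_right)
    then show ?thesis
      using v(1) mult_neg_pos [of l "v \<bullet> v"] by (cases "l < 0") auto
  qed
  ultimately have "lambda_min Q = 0"
    unfolding lambda_min_def
    using finite_eigenvalues assms(1) by (intro Min_eqI) (auto simp: pos_semidef_def)
  then show False
    using assms(2) by simp
qed

section \<open>The upper bound from path-completeness\<close>

text \<open>The first letter is split off: its edge inequality costs a factor
  \<open>\<gamma>\<^sup>2\<close>, and the induction hypothesis is applied to
  \<open>A i *v x\<close> along the path shifted by one.\<close>

lemma path_quadratic_growth:
  assumes "feasible A S E \<gamma> P"
    and "\<And>k. k < length w \<Longrightarrow> (v k, v (Suc k), w ! k) \<in> E"
  shows "(word_prod A w *v x) \<bullet> (P (v (length w)) *v (word_prod A w *v x))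
           \<le> \<gamma> ^ (2 * length w) * (x \<bullet> (P (v 0) *v x))"
  using assms(2)
proof (induction w arbitrary: v x)
  case (Cons i w)
  let ?y = "A i *v x"
  have edge: "(v 0, v (Suc 0), i) \<in> E"
    using Cons.prems [of 0] by simp
  have "(word_prod A w *v ?y) \<bullet> (P (v (Suc (length w))) *v (word_prod A w *v ?y))
      \<le> \<gamma> ^ (2 * length w) * (?y \<bullet> (P (v (Suc 0)) *v ?y))"
    using Cons.IH [of "\<lambda>k. v (Suc k)" ?y] Cons.prems [of "Suc _"] by simp
  also have "\<dots> \<le> \<gamma> ^ (2 * length w) * (\<gamma>\<^sup>2 * (x \<bullet> (P (v 0) *v x)))"
  proof (rule mult_left_mono)
    have "0 \<le> x \<bullet> (edge_slack A \<gamma> P (v 0) (v (Suc 0)) i *v x)"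
      using edge assms(1) by (auto simp: feasible_def pos_semidef_def)
    then show "?y \<bullet> (P (v (Suc 0)) *v ?y) \<le> \<gamma>\<^sup>2 * (x \<bullet> (P (v 0) *v x))"
      by (simp add: inner_edge_slack)
  qed (use assms(1) in \<open>simp add: feasible_def\<close>)
  finally show ?case
    by (simp add: matrix_vector_mul_assoc power2_eq_square mult_ac)
qed simp

text \<open>All forms \<open>P a\<close> are comparable to the squared Euclidean norm with common
  constants \<alpha> and \<beta>, as \<open>S\<close> is finite. Following a path that spells
  \<open>w\<close> then gives \<open>C = sqrt (\<beta> / \<alpha>)\<close>.\<close>

lemma onorm_word_prod_le:
  fixes A :: "nat \<Rightarrow> real^'n^'n"
  assumes "labeled_digraph M S E" "path_complete M S E" "feasible A S E \<gamma> P"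
  obtains C where "C > 0"
    "\<And>w. w \<noteq> [] \<Longrightarrow> set w \<subseteq> {1..M} \<Longrightarrow> onorm ((*v) (word_prod A w)) \<le> C * \<gamma> ^ length w"
proof -
  have "finite S" and pd: "\<And>a. a \<in> S \<Longrightarrow> pos_def (P a)" and "\<gamma> \<ge> 0"
    using assms by (auto simp: labeled_digraph_def feasible_def)
  have "\<forall>a\<in>S. \<exists>c>0. \<forall>x. c * (norm x)\<^sup>2 \<le> x \<bullet> (P a *v x)"
    using pd pos_def_lower_bound by metis
  then obtain c where c: "\<And>a. a \<in> S \<Longrightarrow> c a > 0"
      "\<And>a x. a \<in> S \<Longrightarrow> c a * (norm x)\<^sup>2 \<le> x \<bullet> (P a *v x)"
    by metis
  \<comment> \<open>Inserting 1 keeps the sets under \<open>Min\<close> and \<open>Max\<close>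
    nonempty even for empty \<open>S\<close>, and makes \<beta> positive.\<close>
  define \<alpha> where "\<alpha> = Min (insert 1 (c ` S))"
  define \<beta> where "\<beta> = Max (insert 1 ((\<lambda>a. onorm ((*v) (P a))) ` S))"
  have \<alpha>: "\<alpha> > 0" "\<And>a. a \<in> S \<Longrightarrow> \<alpha> \<le> c a"
    using \<open>finite S\<close> c(1) by (auto simp: \<alpha>_def)
  have "1 \<le> \<beta>"
    using \<open>finite S\<close> unfolding \<beta>_def by (intro Max_ge) auto
  then have \<beta>: "\<beta> > 0" "\<And>a. a \<in> S \<Longrightarrow> onorm ((*v) (P a)) \<le> \<beta>"
    using \<open>finite S\<close> by (linarith, auto simp: \<beta>_def)
  show thesis
  proof
    show "sqrt (\<beta> / \<alpha>) > 0"
      using \<alpha>(1) \<beta>(1) by simp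
    fix w :: "nat list"
    assume w: "w \<noteq> []" "set w \<subseteq> {1..M}"
    let ?K = "length w" and ?W = "word_prod A w"
    \<comment> \<open>\<open>path_complete\<close> counts letters from 1 and lists count from 0,
      hence \<open>w ! (k - 1)\<close>; the path is shifted back when the growth lemma is
      applied.\<close>
    have "\<exists>v. (\<forall>k \<in> {1..?K + 1}. v k \<in> S) \<and> (\<forall>k \<in> {1..?K}. (v k, v (k + 1), w ! (k - 1)) \<in> E)"
    proof (rule assms(2) [unfolded path_complete_def, rule_format])
      show "w ! (k - 1) \<in> {1..M}" if "k \<in> {1..?K}" for k
      proof -
        have "w ! (k - 1) \<in> set w"
          using that by (intro nth_mem) auto
        then show ?thesis
          using w(2) by blast
      qed
    qed (use w(1) in \<open>simp add: Suc_le_eq\<close>)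
    then obtain v where v: "\<And>k. k \<in> {1..?K + 1} \<Longrightarrow> v k \<in> S"
        "\<And>k. k \<in> {1..?K} \<Longrightarrow> (v k, v (k + 1), w ! (k - 1)) \<in> E"
      by blast
    have ends: "v 1 \<in> S" "v (Suc ?K) \<in> S"
      using v(1) by auto
    have "norm (?W *v x) \<le> sqrt (\<beta> / \<alpha>) * \<gamma> ^ ?K * norm x" for x
    proof -
      let ?y = "?W *v x"
      have "\<alpha> * (norm ?y)\<^sup>2 \<le> c (v (Suc ?K)) * (norm ?y)\<^sup>2"
        using \<alpha>(2) ends by (intro mult_right_mono) auto
      also have "\<dots> \<le> ?y \<bullet> (P (v (Suc ?K)) *v ?y)"
        using c(2) ends by blast
      also have "\<dots> \<le> \<gamma> ^ (2 * ?K) * (x \<bullet> (P (v 1) *v x))"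
        using path_quadratic_growth [OF assms(3), of w "\<lambda>k. v (Suc k)" x] v(2) [of "Suc _"] by simp
      also have "\<dots> \<le> \<gamma> ^ (2 * ?K) * (\<beta> * (norm x)\<^sup>2)"
      proof (rule mult_left_mono)
        have "x \<bullet> (P (v 1) *v x) \<le> onorm ((*v) (P (v 1))) * (norm x)\<^sup>2"
          using abs_quadratic_form_le [of x "P (v 1)"] by linarith
        also have "\<dots> \<le> \<beta> * (norm x)\<^sup>2"
          using \<beta>(2) ends by (intro mult_right_mono) auto
        finally show "x \<bullet> (P (v 1) *v x) \<le> \<beta> * (norm x)\<^sup>2" .
      qed (simp add: \<open>\<gamma> \<ge> 0\<close>)
      finally have "(norm ?y)\<^sup>2 \<le> \<beta> / \<alpha> * (\<gamma> ^ ?K)\<^sup>2 * (norm x)\<^sup>2"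
        using \<alpha>(1) by (simp add: field_simps power_mult power2_eq_square power_add mult_2)
      also have "\<dots> = (sqrt (\<beta> / \<alpha>) * \<gamma> ^ ?K * norm x)\<^sup>2"
        using \<alpha>(1) \<beta>(1) by (simp add: power_mult_distrib)
      finally show ?thesis
        using \<alpha>(1) \<beta>(1) \<open>\<gamma> \<ge> 0\<close> by (intro power2_le_imp_le [of "norm ?y"]) auto
    qed
    then show "onorm ((*v) ?W) \<le> sqrt (\<beta> / \<alpha>) * \<gamma> ^ ?K"
      using onorm_le by blast
  qed
qed

section \<open>The lower bound from optimality\<close>

lemma gamma_star_le: "feasible A S E \<gamma> P \<Longrightarrow> gamma_star A S E \<le> \<gamma>"
  unfolding gamma_star_def
  by (rule cInf_lower) (auto simp: feasible_def intro!: bdd_belowI [of _ 0])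

text \<open>The slack is linear in the family of matrices. A definite slack of \<open>P\<close>
  survives small perturbations; a merely semidefinite one becomes definite for every positive
  \<epsilon> if \<open>Q\<close> has definite slack.\<close>

lemma eventually_edge_slack_perturb:
  fixes A :: "nat \<Rightarrow> real^'n^'n"
  assumes "symmetric_matrix (Q a)" "symmetric_matrix (Q b)"
    and "pos_def (edge_slack A \<gamma> P a b i) \<or>
         pos_semidef (edge_slack A \<gamma> P a b i) \<and> pos_def (edge_slack A \<gamma> Q a b i)"
  shows "\<forall>\<^sub>F \<epsilon> in at_right 0. pos_def (edge_slack A \<gamma> (\<lambda>a. P a + \<epsilon> *\<^sub>R Q a) a b i)"
proof -
  have eq: "edge_slack A \<gamma> (\<lambda>a. P a + \<epsilon> *\<^sub>R Q a) a b i
      = edge_slack A \<gamma> P a b i + \<epsilon> *\<^sub>R edge_slack A \<gamma> Q a b i" for \<epsilon>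
  proof -
    have "transpose (A i) ** (P b + \<epsilon> *\<^sub>R Q b) ** A i
        = transpose (A i) ** P b ** A i + \<epsilon> *\<^sub>R (transpose (A i) ** Q b ** A i)"
      unfolding matrix_eq
      by (simp add: matrix_vector_mult_add_rdistrib matrix_vector_right_distrib
          matrix_vector_mult_scaleR scaleR_matrix_vector_assoc [symmetric]
          matrix_vector_mul_assoc [symmetric])
    then show ?thesis
      by (simp add: edge_slack_def scaleR_add_right scaleR_diff_right mult.commute)
  qed
  from assms(3) show ?thesis
  proof
    assume "pos_def (edge_slack A \<gamma> P a b i)"
    then show ?thesis
      unfolding eq using assms by (intro eventually_pos_def_perturb symmetric_matrix_edge_slack)
  next
    assume *: "pos_semidef (edge_slack A \<gamma> P a b i) \<and> pos_def (edge_slack A \<gamma> Q a b i)"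
    show ?thesis
      using eventually_at_right_less
    proof eventually_elim
      case (elim \<epsilon>)
      then show ?case
        unfolding eq using *
        by (auto simp: pos_def_def pos_semidef_def matrix_vector_mult_add_rdistrib inner_add_right
            scaleR_matrix_vector_assoc [symmetric]
            intro!: symmetric_matrix_add symmetric_matrix_scaleR add_nonneg_pos)
    qed
  qed
qed

text \<open>Definite slacks leave room to subtract \<open>\<delta> *\<^sub>R P a\<close> on the
  finitely many edges, which amounts to replacing \<gamma> by
  \<open>sqrt (\<gamma>\<^sup>2 - \<delta>)\<close> with the same \<open>P\<close>.\<close>

lemma gamma_star_less_if_strictly_feasible:
  fixes A :: "nat \<Rightarrow> real^'n^'n"
  assumes "finite E" "E \<subseteq> S \<times> S \<times> UNIV" "\<gamma> > 0" "\<And>a. a \<in> S \<Longrightarrow> pos_def (P a)"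
    and "\<And>a b i. (a, b, i) \<in> E \<Longrightarrow> pos_def (edge_slack A \<gamma> P a b i)"
  shows "gamma_star A S E < \<gamma>"
proof -
  have "\<forall>\<^sub>F \<delta> in at_right 0. \<forall>(a, b, i) \<in> E. pos_def (edge_slack A \<gamma> P a b i + \<delta> *\<^sub>R (- P a))"
  proof (intro eventually_ball_finite assms(1) ballI, clarify)
    fix a b i
    assume e: "(a, b, i) \<in> E"
    then have "symmetric_matrix (P a)"
      using assms(2,4) by (auto simp: pos_def_def)
    then have "symmetric_matrix (- P a)"
      using symmetric_matrix_scaleR [of "P a" "-1"] by simp
    then show "\<forall>\<^sub>F \<delta> in at_right 0. pos_def (edge_slack A \<gamma> P a b i + \<delta> *\<^sub>R (- P a))"
      using e assms(5) by (intro eventually_pos_def_perturb)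
  qed
  moreover have "\<forall>\<^sub>F \<delta> in at_right 0. \<delta> < \<gamma>\<^sup>2"
    using assms(3) by (intro order_tendstoD(2) [OF tendsto_ident_at]) simp
  moreover have "\<forall>\<^sub>F \<delta> in at_right 0. (0::real) < \<delta>"
    by (rule eventually_at_right_less)
  ultimately have "\<forall>\<^sub>F \<delta> in at_right 0. \<delta> < \<gamma>\<^sup>2 \<and> 0 < \<delta> \<and>
      (\<forall>(a, b, i) \<in> E. pos_def (edge_slack A \<gamma> P a b i + \<delta> *\<^sub>R (- P a)))"
    by eventually_elim blast
  then obtain \<delta> where \<delta>: "0 < \<delta>" "\<delta> < \<gamma>\<^sup>2"
      "\<And>a b i. (a, b, i) \<in> E \<Longrightarrow> pos_def (edge_slack A \<gamma> P a b i + \<delta> *\<^sub>R (- P a))"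
    using eventually_happens' [OF trivial_limit_at_right_real] by blast
  let ?g = "sqrt (\<gamma>\<^sup>2 - \<delta>)"
  have "edge_slack A ?g P a b i = edge_slack A \<gamma> P a b i + \<delta> *\<^sub>R (- P a)" for a b i
    using \<delta>(2) by (simp add: edge_slack_def algebra_simps)
  then have "feasible A S E ?g P"
    using \<delta> assms(4) pos_def_imp_pos_semidef by (fastforce simp: feasible_def)
  then have "gamma_star A S E \<le> ?g"
    by (rule gamma_star_le)
  also have "?g < \<gamma>"
    using \<delta>(1) assms(3) by (intro real_less_lsqrt) auto
  finally show ?thesis .
qed

section \<open>Products along tight paths and their Gram sums\<close>

text \<open>\<open>SOME\<close> makes this total for arbitrary edge sets; a dead end contributes 0,
  which annihilates every product reaching it too early. The first edge is split off as in
  \<open>word_prod\<close>.\<close>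

primrec path_matrix :: "(nat \<Rightarrow> real^'n^'n) \<Rightarrow> 'a ledge set \<Rightarrow> nat \<Rightarrow> 'a \<Rightarrow> real^'n^'n" where
  "path_matrix A T 0 a = mat 1"
| "path_matrix A T (Suc k) a =
     (if outgoing T a = {} then 0
      else case (SOME e. e \<in> outgoing T a) of (_, b, i) \<Rightarrow> path_matrix A T k b ** A i)"

lemma path_matrix_step:
  assumes "(a, b, i) \<in> T" "\<And>b' i'. (a, b', i') \<in> T \<Longrightarrow> b' = b \<and> i' = i"
  shows "path_matrix A T (Suc k) a = path_matrix A T k b ** A i"
proof -
  have "outgoing T a = {(a, b, i)}"
    by (auto simp: outgoing_def assms(1) dest: assms(2))
  then show ?thesis
    by simp
qed

text \<open>This transfers norm bounds on words of length \<open>k\<close> to tight paths.\<close>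

lemma path_matrix_eq_word_prod:
  assumes "T \<subseteq> UNIV \<times> UNIV \<times> {1..M}"
  shows "path_matrix A T k a = 0 \<or>
    (\<exists>w. length w = k \<and> set w \<subseteq> {1..M} \<and> path_matrix A T k a = word_prod A w)"
proof (induction k arbitrary: a)
  case (Suc k)
  show ?case
  proof (cases "outgoing T a = {}")
    case False
    obtain a' b i where e: "(SOME e. e \<in> outgoing T a) = (a', b, i)"
      by (rule prod_cases3)
    have "(SOME e. e \<in> outgoing T a) \<in> outgoing T a"
      using False by (simp only: some_in_eq not_False_eq_True)
    then have "(a', b, i) \<in> outgoing T a"
      by (simp only: e)
    then have i: "i \<in> {1..M}"
      using assms by (auto simp: outgoing_def)
    have *: "path_matrix A T (Suc k) a = path_matrix A T k b ** A i"
      using False e by simp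
    from Suc.IH [of b] show ?thesis
    proof
      assume "path_matrix A T k b = 0"
      then show ?thesis
        unfolding * by (simp add: matrix_matrix_mult_def vec_eq_iff)
    next
      assume "\<exists>w. length w = k \<and> set w \<subseteq> {1..M} \<and> path_matrix A T k b = word_prod A w"
      then obtain w where "length w = k" "set w \<subseteq> {1..M}" "path_matrix A T k b = word_prod A w"
        by blast
      with i show ?thesis
        unfolding * by (intro disjI2 exI [of _ "i # w"]) auto
    qed
  qed simp
qed simp

text \<open>For positive \<gamma> this is a truncated Lyapunov sum with weights
  \<open>\<gamma>\<close> to the power \<open>-2k\<close>, rescaled so that only nonnegative powers
  occur.\<close>

definition path_gram ::
  "(nat \<Rightarrow> real^'n^'n) \<Rightarrow> 'a ledge set \<Rightarrow> real \<Rightarrow> nat \<Rightarrow> 'a \<Rightarrow> real^'n^'n" where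
  "path_gram A T \<gamma> N a =
     (\<Sum>k<N. \<gamma> ^ (2 * (N - Suc k)) *\<^sub>R (transpose (path_matrix A T k a) ** path_matrix A T k a))"

lemma symmetric_path_gram: "symmetric_matrix (path_gram A T \<gamma> N a)"
  by (simp add: symmetric_matrix_def path_gram_def transpose_sum transpose_scaleR matrix_transpose_mul)

lemma inner_path_gram:
  fixes A :: "nat \<Rightarrow> real^'n^'n"
  shows "x \<bullet> (path_gram A T \<gamma> N a *v x) =
     (\<Sum>k<N. \<gamma> ^ (2 * (N - Suc k)) * (norm (path_matrix A T k a *v x))\<^sup>2)"
proof -
  have sum_mult: "(\<Sum>k\<in>I. F k) *v x = (\<Sum>k\<in>I. F k *v x)" for I and F :: "nat \<Rightarrow> real^'n^'n" and x
    by (induction I rule: infinite_finite_induct) (simp_all add: matrix_vector_mult_add_rdistrib)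
  have "x \<bullet> ((transpose B ** B) *v x) = (norm (B *v x))\<^sup>2" for B :: "real^'n^'n" and x
    using inner_congruence [of x B "mat 1"]
    by (simp only: matrix_mul_rid matrix_vector_mul_lid power2_norm_eq_inner)
  then show ?thesis
    by (simp only: path_gram_def sum_mult inner_sum_right inner_scaleR_right
        scaleR_matrix_vector_assoc [symmetric])
qed

text \<open>Since the tight edge out of \<open>a\<close> is unique, prefixing it turns the sum at
  \<open>b\<close> into the sum at \<open>a\<close> shifted by one index. The difference telescopes
  to the terms \<open>k = 0\<close> and \<open>k = N\<close>.\<close>

lemma inner_edge_slack_path_gram:
  assumes "(a, b, i) \<in> T" "\<And>b' i'. (a, b', i') \<in> T \<Longrightarrow> b' = b \<and> i' = i"
  shows "x \<bullet> (edge_slack A \<gamma> (path_gram A T \<gamma> N) a b i *v x) =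
           \<gamma> ^ (2 * N) * (norm x)\<^sup>2 - (norm (path_matrix A T N a *v x))\<^sup>2"
proof -
  let ?f = "\<lambda>k. \<gamma> ^ (2 * (N - k)) * (norm (path_matrix A T k a *v x))\<^sup>2"
  have step: "path_matrix A T (Suc k) a = path_matrix A T k b ** A i" for k
    by (intro path_matrix_step assms)
  have "\<gamma>\<^sup>2 * (x \<bullet> (path_gram A T \<gamma> N a *v x)) = (\<Sum>k<N. ?f k)"
    unfolding inner_path_gram sum_distrib_left
  proof (rule sum.cong)
    fix k assume "k \<in> {..<N}"
    \<comment> \<open>Subtraction on naturals is truncated, so \<open>k < N\<close> matters
      here.\<close>
    then have eq: "2 * (N - k) = 2 + 2 * (N - Suc k)"
      by auto
    show "\<gamma>\<^sup>2 * (\<gamma> ^ (2 * (N - Suc k)) * (norm (path_matrix A T k a *v x))\<^sup>2) = ?f k"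
      unfolding eq power_add by (simp only: mult.assoc)
  qed simp
  moreover have "(A i *v x) \<bullet> (path_gram A T \<gamma> N b *v (A i *v x)) = (\<Sum>k<N. ?f (Suc k))"
    unfolding inner_path_gram by (simp only: step matrix_vector_mul_assoc)
  ultimately have "x \<bullet> (edge_slack A \<gamma> (path_gram A T \<gamma> N) a b i *v x) = (\<Sum>k<N. ?f k - ?f (Suc k))"
    by (simp only: inner_edge_slack sum_subtractf)
  also have "\<dots> = ?f 0 - ?f N"
    by (rule sum_lessThan_telescope' [of ?f])
  finally show ?thesis
    by simp
qed

section \<open>Words of every length that attain the optimal growth\<close>

lemma exists_word_onorm_ge:
  fixes A :: "nat \<Rightarrow> real^'n^'n"
  assumes "M \<ge> 1" "labeled_digraph M S E" "feasible A S E \<gamma> P" "\<gamma> = gamma_star A S E"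
    and "\<forall>a \<in> S. card (outgoing (tight_edges A E \<gamma> P) a) \<le> 1" and "N \<ge> 1"
  shows "\<exists>w. length w = N \<and> set w \<subseteq> {1..M} \<and> \<gamma> ^ N \<le> onorm ((*v) (word_prod A w))"
proof (rule ccontr)
  assume neg: "\<not> ?thesis"
  have small: "onorm ((*v) (word_prod A w)) < \<gamma> ^ N" if "length w = N" "set w \<subseteq> {1..M}" for w
    using neg that by force
  \<comment> \<open>The word of \<open>N\<close> ones is admissible because
    \<open>M \<ge> 1\<close>; nonnegativity of its norm gives \<open>\<gamma> ^ N > 0\<close>, and
    with \<open>N \<ge> 1\<close> this rules out \<open>\<gamma> = 0\<close>.\<close>
  have "onorm ((*v) (word_prod A (replicate N 1))) < \<gamma> ^ N"
    using assms(1) by (intro small) (auto simp: set_replicate_conv_if)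
  then have "\<gamma> ^ N > 0"
    using onorm_pos_le [OF matrix_vector_mul_bounded_linear, of "word_prod A (replicate N 1)"]
    by linarith
  have E: "finite E" "E \<subseteq> S \<times> S \<times> {1..M}" and "finite S"
    using assms(2) finite_subset [of E "S \<times> S \<times> {1..M}"] by (auto simp: labeled_digraph_def)
  have feas: "\<gamma> \<ge> 0" "\<And>a. a \<in> S \<Longrightarrow> pos_def (P a)"
      "\<And>a b i. (a, b, i) \<in> E \<Longrightarrow> pos_semidef (edge_slack A \<gamma> P a b i)"
    using assms(3) by (auto simp: feasible_def)
  define T where "T = tight_edges A E \<gamma> P"
  have "T \<subseteq> E"
    by (auto simp: T_def tight_edges_def)
  have unique: "b' = b \<and> i' = i" if "(a, b, i) \<in> T" "(a, b', i') \<in> T" for a b i b' i'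
  proof -
    \<comment> \<open>An infinite set has \<open>card\<close> 0, so finiteness is established before
      the cardinality bound is turned into uniqueness.\<close>
    have "a \<in> S" "finite (outgoing T a)"
      using that(1) \<open>T \<subseteq> E\<close> E finite_subset [of "outgoing T a" E] by (auto simp: outgoing_def)
    moreover from this have "card (outgoing T a) \<le> Suc 0"
      using assms(5) by (simp add: T_def)
    moreover have "(a, b, i) \<in> outgoing T a" "(a, b', i') \<in> outgoing T a"
      using that by (simp_all add: outgoing_def)
    ultimately have "(a, b', i') = (a, b, i)"
      by (auto simp only: card_le_Suc0_iff_eq)
    then show ?thesis
      by simp
  qed
  have path_small: "norm (path_matrix A T N a *v x) < \<gamma> ^ N * norm x" if "x \<noteq> 0" for a x
  proof (cases "path_matrix A T N a = 0")
    case True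
    then show ?thesis
      using that \<open>\<gamma> ^ N > 0\<close> by simp
  next
    case False
    then obtain w where w: "length w = N" "set w \<subseteq> {1..M}" "path_matrix A T N a = word_prod A w"
      using path_matrix_eq_word_prod [of T M A N a] \<open>T \<subseteq> E\<close> E by blast
    have "norm (path_matrix A T N a *v x) \<le> onorm ((*v) (word_prod A w)) * norm x"
      unfolding w(3) by (intro onorm matrix_vector_mul_bounded_linear)
    also have "\<dots> < \<gamma> ^ N * norm x"
      using small [OF w(1,2)] that by simp
    finally show ?thesis .
  qed
  let ?Q = "path_gram A T \<gamma> N"
  have "pos_def (edge_slack A \<gamma> ?Q a b i)" if "(a, b, i) \<in> T" for a b i
    unfolding pos_def_def
  proof (intro conjI allI impI)
    fix x :: "real^'n"
    assume "x \<noteq> 0"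
    then have "(norm (path_matrix A T N a *v x))\<^sup>2 < (\<gamma> ^ N * norm x)\<^sup>2"
      by (intro power_strict_mono path_small) auto
    also have "\<dots> = \<gamma> ^ (2 * N) * (norm x)\<^sup>2"
      by (simp add: power_mult_distrib power_mult [symmetric] mult.commute)
    finally show "0 < x \<bullet> (edge_slack A \<gamma> ?Q a b i *v x)"
      by (simp only: inner_edge_slack_path_gram [OF that unique [OF that]] diff_gt_0_iff_gt)
  qed (intro symmetric_matrix_edge_slack symmetric_path_gram)
  \<comment> \<open>Outside \<open>T\<close> strictness comes from \<open>P\<close> itself; on tight
    edges it comes from \<open>?Q\<close>.\<close>
  moreover have "pos_def (edge_slack A \<gamma> P a b i)" if "(a, b, i) \<in> E" "(a, b, i) \<notin> T" for a b i
    using that feas(3) by (intro pos_def_if_lambda_min_nonzero) (auto simp: T_def tight_edges_def)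
  ultimately have "pos_def (edge_slack A \<gamma> P a b i) \<or>
      pos_semidef (edge_slack A \<gamma> P a b i) \<and> pos_def (edge_slack A \<gamma> ?Q a b i)"
    if "(a, b, i) \<in> E" for a b i
    using that feas(3) by blast
  then have "\<forall>\<^sub>F \<epsilon> in at_right 0. pos_def (edge_slack A \<gamma> (\<lambda>a. P a + \<epsilon> *\<^sub>R ?Q a) a b i)"
    if "(a, b, i) \<in> E" for a b i
    using that by (intro eventually_edge_slack_perturb symmetric_path_gram)
  then have "\<forall>\<^sub>F \<epsilon> in at_right 0. \<forall>(a, b, i) \<in> E.
      pos_def (edge_slack A \<gamma> (\<lambda>a. P a + \<epsilon> *\<^sub>R ?Q a) a b i)"
    using E(1) by (intro eventually_ball_finite) auto
  moreover have "\<forall>\<^sub>F \<epsilon> in at_right 0. \<forall>a\<in>S. pos_def (P a + \<epsilon> *\<^sub>R ?Q a)"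
    using \<open>finite S\<close> feas(2)
    by (intro eventually_ball_finite ballI eventually_pos_def_perturb symmetric_path_gram)
  ultimately have "\<forall>\<^sub>F \<epsilon> in at_right 0. (\<forall>(a, b, i) \<in> E.
      pos_def (edge_slack A \<gamma> (\<lambda>a. P a + \<epsilon> *\<^sub>R ?Q a) a b i)) \<and> (\<forall>a\<in>S. pos_def (P a + \<epsilon> *\<^sub>R ?Q a))"
    by (rule eventually_conj)
  \<comment> \<open>One \<epsilon> serves all edges and nodes, since both sets are finite.\<close>
  then obtain \<epsilon> where \<epsilon>: "\<And>a b i. (a, b, i) \<in> E \<Longrightarrow>
      pos_def (edge_slack A \<gamma> (\<lambda>a. P a + \<epsilon> *\<^sub>R ?Q a) a b i)" "\<And>a. a \<in> S \<Longrightarrow> pos_def (P a + \<epsilon> *\<^sub>R ?Q a)"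
    using eventually_happens' [OF trivial_limit_at_right_real] by blast
  have "gamma_star A S E < \<gamma>"
    using E \<epsilon> \<open>\<gamma> ^ N > 0\<close> \<open>N \<ge> 1\<close> feas(1)
    by (intro gamma_star_less_if_strictly_feasible [of E S \<gamma> "\<lambda>a. P a + \<epsilon> *\<^sub>R ?Q a"])
      (auto simp: less_le)
  then show False
    using assms(4) by simp
qed

section \<open>Squeezing the normalised word norms\<close>

theorem theorem4:
  fixes M :: nat
    and A :: "nat \<Rightarrow> real^'n^'n"
    and S :: "'a set"
    and E :: "('a \<times> 'a \<times> nat) set"
    and \<gamma> :: real
    and P :: "'a \<Rightarrow> real^'n^'n"
  assumes "M \<ge> 1"
    and "labeled_digraph M S E"
    and "path_complete M S E"
    and "feasible A S E \<gamma> P"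
    and "\<gamma> = gamma_star A S E"
    and "\<forall>a \<in> S. card (outgoing (tight_edges A E \<gamma> P) a) \<le> 1"
  shows "gamma_star A S E = joint_spectral_radius M A"
proof -
  let ?W = "\<lambda>k. {w. length w = k \<and> set w \<subseteq> {1..M}}"
  let ?f = "\<lambda>k w. onorm ((*v) (word_prod A w)) powr (1 / real k)"
  let ?m = "\<lambda>k. Max (?f k ` ?W k)"
  obtain C where C: "C > 0"
    "\<And>w. w \<noteq> [] \<Longrightarrow> set w \<subseteq> {1..M} \<Longrightarrow> onorm ((*v) (word_prod A w)) \<le> C * \<gamma> ^ length w"
    using onorm_word_prod_le [OF assms(2-4)] by blast
  have "\<gamma> \<ge> 0"
    using assms(4) by (simp add: feasible_def)
  \<comment> \<open>The case \<open>\<gamma> = 0\<close> is separate: \<open>powr_realpow\<close>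
    requires a positive base, while \<open>0 powr x\<close> is 0.\<close>
  have root: "(\<gamma> ^ k) powr (1 / real k) = \<gamma>" if "k \<ge> 1" for k
    using that \<open>\<gamma> \<ge> 0\<close> by (cases "\<gamma> = 0") (auto simp: powr_realpow [symmetric] powr_powr)
  have bounds: "\<gamma> \<le> ?m k \<and> ?m k \<le> C powr (1 / real k) * \<gamma>" if k: "k \<ge> 1" for k
  proof -
    have fin: "finite (?W k)"
      using finite_lists_length_eq [of "{1..M}" k] by (simp add: conj_commute)
    obtain w where w: "w \<in> ?W k" "\<gamma> ^ k \<le> onorm ((*v) (word_prod A w))"
      using exists_word_onorm_ge [OF assms(1,2,4-6) k] by blast
    have "\<gamma> \<le> ?f k w"
      using powr_mono2 [OF _ _ w(2), of "1 / real k"] root [OF k] \<open>\<gamma> \<ge> 0\<close> by simp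
    also have "\<dots> \<le> ?m k"
      using fin w(1) by (intro Max_ge) auto
    finally have "\<gamma> \<le> ?m k" .
    moreover have "?f k w \<le> C powr (1 / real k) * \<gamma>" if "w \<in> ?W k" for w
    proof -
      have "onorm ((*v) (word_prod A w)) \<le> C * \<gamma> ^ k"
        using C(2) [of w] that k by (cases w) auto
      then have "?f k w \<le> (C * \<gamma> ^ k) powr (1 / real k)"
        by (intro powr_mono2 onorm_pos_le matrix_vector_mul_bounded_linear) auto
      then show ?thesis
        using root [OF k] C(1) \<open>\<gamma> \<ge> 0\<close> by (simp add: powr_mult)
    qed
    then have "?m k \<le> C powr (1 / real k) * \<gamma>"
      using fin w(1) by (intro Max.boundedI) auto
    ultimately show ?thesis ..
  qed
  \<comment> \<open>As \<open>C > 0\<close>, its roots tend to 1, so the constant disappears in the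
    limit.\<close>
  have "(\<lambda>k. C powr (1 / real k) * \<gamma>) \<longlonglongrightarrow> C powr 0 * \<gamma>"
    using C(1) by (intro tendsto_intros lim_1_over_n) auto
  then have upper: "(\<lambda>k. C powr (1 / real k) * \<gamma>) \<longlonglongrightarrow> \<gamma>"
    using C(1) by simp
  have "?m \<longlonglongrightarrow> \<gamma>"
    by (rule tendsto_sandwich [OF _ _ tendsto_const upper])
      (use bounds in \<open>auto intro!: eventually_sequentiallyI [of 1]\<close>)
  then show ?thesis
    unfolding joint_spectral_radius_def using assms(5) by (simp add: limI)
qed

end
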